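(* Let $G=(V,E)\in\mathcal{G}$, let $\omega^u$ be an MCP upper-bound function (not assumed increasing), let $K\subseteq V$ be a set of size $k\ge1$, and let $G'=\mathrm{core}(G,k-1,\omega^u)$ be the output of the peeling procedure described in the context. Then $$K\text{ is a clique in }G\iff K\text{ is a clique in }G'.$$
   Context: $\mathcal{G}$ is the class of all finite, simple, undirected graphs, and $\mathbb{N}_0=\{0,1,2,\dots\}$. $N_G(v)$ is the neighborhood of $v$, $G[S]$ the induced subgraph, $G\setminus v$ denotes vertex deletion, and $\omega(G)$ is the clique number. A set $K$ is a clique in a graph $H$ if $K\subseteq V(H)$ and every two distinct vertices of $K$ are adjacent in $H$. $\omega^u:\mathcal{G}\to\mathbb{N}_0$ is an MCP upper-bound function if $\omega(G)\le\omega^u(G)\le|V(G)|$ for every $G\in\mathcal{G}$. Procedure $\mathrm{core}(G,k,\omega^u)$ (for an integer $k\ge0$): set $Q_V\leftarrow V(G)$. While $Q_V\neq\emptyset$: pick and remove an (arbitrary) element $v$ of $Q_V$; if $\omega^u(G[N_G(v)])<k$ for the current graph $G$, then set $Q_V\leftarrow Q_V\cup N_G(v)$ and $G\leftarrow G\setminus v$. When $Q_V=\emptyset$, return the current graph $G$. *)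

theory Defs
  imports "Graph_Theory.Digraph_Component"
begin

text \<open>
  A finite simple undirected graph is a member of the locale \<^locale>\<open>graph\<close>: a finite, loop-free
  digraph without parallel arcs whose adjacency relation is symmetric (the null graph is allowed).
  Deletion of a vertex and induced subgraphs are \<^const>\<open>pre_digraph.del_vert\<close> and
  \<^const>\<open>induce_subgraph\<close>.
\<close>

definition neighborhood :: "('a, 'b) pre_digraph \<Rightarrow> 'a \<Rightarrow> 'a set" where
  "neighborhood G v = {u \<in> verts G. v \<rightarrow>\<^bsub>G\<^esub> u}"

definition clique :: "'a set \<Rightarrow> ('a, 'b) pre_digraph \<Rightarrow> bool" where
  "clique K G \<longleftrightarrow> K \<subseteq> verts G \<and> (\<forall>u\<in>K. \<forall>v\<in>K. u \<noteq> v \<longrightarrow> u \<rightarrow>\<^bsub>G\<^esub> v)"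

definition clique_number :: "('a, 'b) pre_digraph \<Rightarrow> nat" where
  "clique_number G = Max (card ` {K. clique K G})"

text \<open>
  The values of the bound outside the class of finite simple graphs are irrelevant. No monotonicity
  under taking subgraphs is required, nor that the bound agree on isomorphic graphs or on
  different records that represent the same graph.
\<close>

definition mcp_upper_bound :: "(('a, 'b) pre_digraph \<Rightarrow> nat) \<Rightarrow> bool" where
  "mcp_upper_bound \<omega>u \<longleftrightarrow>
     (\<forall>G. graph G \<longrightarrow> clique_number G \<le> \<omega>u G \<and> \<omega>u G \<le> card (verts G))"

text \<open>
  One iteration of the peeling loop. A state consists of the queue and the current graph.
  As the vertex taken from the queue is arbitrary, the loop body is a relation.
\<close>

inductive core_step ::
  "(('a, 'b) pre_digraph \<Rightarrow> nat) \<Rightarrow> nat \<Rightarrow>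
   'a set \<times> ('a, 'b) pre_digraph \<Rightarrow> 'a set \<times> ('a, 'b) pre_digraph \<Rightarrow> bool"
  for \<omega>u k where
  peel: "\<lbrakk>v \<in> Q; \<omega>u (G \<restriction> neighborhood G v) < k\<rbrakk> \<Longrightarrow>
     core_step \<omega>u k (Q, G) ((Q - {v}) \<union> neighborhood G v, pre_digraph.del_vert G v)"
| keep: "\<lbrakk>v \<in> Q; \<not> \<omega>u (G \<restriction> neighborhood G v) < k\<rbrakk> \<Longrightarrow>
     core_step \<omega>u k (Q, G) (Q - {v}, G)"

text \<open>
  \<open>core_output \<omega>u k G G'\<close>: some run of the procedure on \<open>G\<close>, that is, some sequence of choices,
  returns \<open>G'\<close>. The lemmas below show that every run on a finite simple graph terminates, so an
  output always exists.
\<close>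

definition core_output ::
  "(('a, 'b) pre_digraph \<Rightarrow> nat) \<Rightarrow> nat \<Rightarrow>
   ('a, 'b) pre_digraph \<Rightarrow> ('a, 'b) pre_digraph \<Rightarrow> bool" where
  "core_output \<omega>u k G G' \<longleftrightarrow> (core_step \<omega>u k)\<^sup>*\<^sup>* (verts G, G) ({}, G')"

definition core_state :: "'a set \<times> ('a, 'b) pre_digraph \<Rightarrow> bool" where
  "core_state s \<longleftrightarrow> graph (snd s) \<and> fst s \<subseteq> verts (snd s)"

lemma graph_del_vert:
  assumes "graph G"
  shows "graph (pre_digraph.del_vert G v)"
proof -
  interpret graph G by fact
  have "symmetric (del_vert v)"
    using sym_arcs unfolding symmetric_conv del_vert_simps by fastforce
  then show ?thesis
    using finite_verts finite_arcs no_loops no_multi_arcs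
    by unfold_locales (auto simp: del_vert_simps arc_to_ends_def)
qed

lemma core_step_state:
  assumes "core_step \<omega>u k s t" "core_state s"
  shows "core_state t"
  using assms
proof cases
  case (peel v Q G)
  then interpret graph G using assms(2) by (simp add: core_state_def)
  have "v \<notin> neighborhood G v" by (auto simp: neighborhood_def dest: adj_not_same)
  then show ?thesis using peel assms(2)
    by (auto simp: core_state_def graph_del_vert del_vert_simps neighborhood_def)
qed (auto simp: core_state_def)

lemma core_step_terminates:
  "wfP (\<lambda>t s. core_state s \<and> core_step \<omega>u k s t)"
proof -
  let ?R = "measures [\<lambda>s :: 'a set \<times> ('a, 'b) pre_digraph. card (verts (snd s)), \<lambda>s. card (fst s)]"
  have "wf ?R" by simp
  moreover have "{(t, s). core_state s \<and> core_step \<omega>u k s t} \<subseteq> ?R"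
  proof clarify
    fix Q G Q' G'
    assume s: "core_state (Q, G)" and st: "core_step \<omega>u k (Q, G) (Q', G')"
    interpret graph G using s by (simp add: core_state_def)
    have Q: "finite Q" "Q \<subseteq> verts G" using s by (auto simp: core_state_def intro: finite_subset)
    from st show "((Q', G'), Q, G) \<in> ?R"
    proof cases
      case (peel v)
      then have "card (verts G - {v}) < card (verts G)"
        using Q by (intro card_Diff1_less) auto
      with peel show ?thesis by (simp add: del_vert_simps)
    next
      case (keep v)
      then have "card (Q - {v}) < card Q"
        using Q by (intro card_Diff1_less) auto
      with keep show ?thesis by simp
    qed
  qed
  ultimately show ?thesis unfolding wfp_def by (rule wf_subset)
qed

lemma core_output_exists:
  assumes "graph G"
  shows "\<exists>G'. core_output \<omega>u k G G'"
proof -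
  have "core_state s \<Longrightarrow> \<exists>G'. (core_step \<omega>u k)\<^sup>*\<^sup>* s ({}, G')" for s :: "'a set \<times> ('a, 'b) pre_digraph"
  proof (induction s rule: wfp_induct_rule[OF core_step_terminates[of \<omega>u k]])
    case (1 s)
    obtain Q H where s: "s = (Q, H)" by (cases s)
    show ?case
    proof (cases "Q = {}")
      case False
      then obtain t where t: "core_step \<omega>u k s t" unfolding s by (meson all_not_in_conv core_step.intros)
      then have "\<exists>G'. (core_step \<omega>u k)\<^sup>*\<^sup>* t ({}, G')" using 1 core_step_state by blast
      with t show ?thesis by (meson converse_rtranclp_into_rtranclp)
    qed (auto simp: s)
  qed
  from this[of "(verts G, G)"] show ?thesis
    using assms by (simp add: core_state_def core_output_def)
qed

end

theory Submission
  imports Defs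
begin

text \<open>
  A clique \<open>K\<close> through \<open>v\<close> consists of \<open>v\<close> and a clique on \<open>card K - 1\<close> vertices inside the
  neighborhood of \<open>v\<close>. An upper bound on the clique number of that neighborhood is therefore at
  least \<open>card K - 1\<close>, so the threshold \<open>card K - 1\<close> never lets the procedure peel a vertex of
  \<open>K\<close> (\<open>card_clique_le_upper_bound\<close>); the clique survives every iteration
  (\<open>core_step_clique_iff\<close>). Conversely, peeling creates no edges, so a clique of the output was
  already one in the input. Each iteration uses the upper bound on a single graph, the
  neighborhood in the current graph, and compares it with the clique number of that same graph;
  values of the bound on different graphs never have to be related to each other.
\<close>

lemma dominates_induce_subgraph_iff:
  "u \<rightarrow>\<^bsub>G \<restriction> S\<^esub> w \<longleftrightarrow> u \<rightarrow>\<^bsub>G\<^esub> w \<and> u \<in> S \<and> w \<in> S"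
  by (auto simp: arcs_ends_def arc_to_ends_def image_iff)

lemma dominates_del_vert_iff:
  "u \<rightarrow>\<^bsub>pre_digraph.del_vert G v\<^esub> w \<longleftrightarrow> u \<rightarrow>\<^bsub>G\<^esub> w \<and> u \<noteq> v \<and> w \<noteq> v"
  by (auto simp: arcs_ends_def arc_to_ends_def image_iff pre_digraph.del_vert_simps)

lemma (in graph) graph_induce_subgraph:
  assumes "S \<subseteq> verts G"
  shows "graph (G \<restriction> S)"
  using assms sym_arcs
  by (meson digraph.graphI digraphI_induced induced_graph_imp_symmetric induced_induce)

lemma clique_induce_neighborhood:
  assumes "clique K G" and "v \<in> K"
  shows "clique (K - {v}) (G \<restriction> neighborhood G v)"
  using assms by (auto simp: clique_def neighborhood_def dominates_induce_subgraph_iff)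

lemma card_clique_le_clique_number:
  assumes "clique K G" and "finite (verts G)"
  shows "card K \<le> clique_number G"
proof -
  have "{K. clique K G} \<subseteq> Pow (verts G)"
    by (auto simp: clique_def)
  then have "finite {K. clique K G}"
    using assms(2) by (meson finite_Pow_iff finite_subset)
  then show ?thesis
    using assms(1) unfolding clique_number_def by (intro Max_ge) auto
qed

lemma (in graph) card_clique_le_upper_bound:
  assumes "mcp_upper_bound \<omega>u" and "clique K G" and "v \<in> K"
  shows "card K - 1 \<le> \<omega>u (G \<restriction> neighborhood G v)"
proof -
  let ?N = "G \<restriction> neighborhood G v"
  have N: "graph ?N"
    by (rule graph_induce_subgraph) (auto simp: neighborhood_def)
  then interpret N: graph ?N .
  have "card K - 1 = card (K - {v})"
    using assms(3) by simp
  also have "\<dots> \<le> clique_number ?N"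
    using clique_induce_neighborhood[OF assms(2,3)] N.finite_verts
    by (rule card_clique_le_clique_number)
  also have "\<dots> \<le> \<omega>u ?N"
    using assms(1) N by (simp add: mcp_upper_bound_def)
  finally show ?thesis .
qed

lemma clique_del_vert_iff:
  "clique K (pre_digraph.del_vert G v) \<longleftrightarrow> clique K G \<and> v \<notin> K"
  by (auto simp: clique_def dominates_del_vert_iff pre_digraph.del_vert_simps)

lemma core_step_clique_iff:
  assumes "core_step \<omega>u (card K - 1) s t" and "graph (snd s)" and "mcp_upper_bound \<omega>u"
  shows "clique K (snd s) \<longleftrightarrow> clique K (snd t)"
  using assms(1)
proof cases
  case (peel v Q G)
  then interpret graph G using assms(2) by simp
  have "v \<notin> K" if "clique K G"
    using card_clique_le_upper_bound[OF assms(3) that, of v] peel(4) by linarith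
  then show ?thesis
    using peel by (auto simp: clique_del_vert_iff)
qed simp

text \<open>
  The invariant \<^const>\<open>core_state\<close> is carried along because the bound is only meaningful on
  finite simple graphs, so every intermediate graph of the run has to be one.
\<close>

lemma core_run_clique_iff:
  assumes "(core_step \<omega>u (card K - 1))\<^sup>*\<^sup>* s t" and "core_state s" and "mcp_upper_bound \<omega>u"
  shows "core_state t \<and> (clique K (snd s) \<longleftrightarrow> clique K (snd t))"
  using assms(1)
proof (induction rule: rtranclp_induct)
  case base
  show ?case using assms(2) by simp
next
  case (step t u)
  then have "graph (snd t)" by (simp add: core_state_def)
  with step assms(3) show ?case
    using core_step_clique_iff core_step_state by blast
qed

theorem proposition12:
  fixes G G' :: "('a, 'b) pre_digraph"
    and \<omega>u :: "('a, 'b) pre_digraph \<Rightarrow> nat"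
    and K :: "'a set" and k :: nat
  assumes "graph G"
    and "mcp_upper_bound \<omega>u"
    and "K \<subseteq> verts G" and "card K = k" and "k \<ge> 1"
    and "core_output \<omega>u (k - 1) G G'"
  shows "clique K G \<longleftrightarrow> clique K G'"
proof -
  have "core_state (verts G, G)"
    using assms(1) by (simp add: core_state_def)
  then show ?thesis
    using core_run_clique_iff[of \<omega>u K "(verts G, G)" "({}, G')"] assms(2,4,6)
    by (simp add: core_output_def)
qed

end
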